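(* Let $P(x)=c_0+c_1x+\ldots+c_dx^d\in\mathbb{Z}[x]$ and let $n_0\ge 2$ be an integer such that $$c_0=(-1)^{n_0}\quad\text{and}\quad x^dP\big((-1)^{n_0-1}x^{-1}\big)=C\cdot P(x)\ \text{ for some non-zero constant } C.$$ Consider all integer tuples $(a_0,a_1,\ldots,a_n)$, where $n$ ranges over the integers $n\ge 2$ of the same parity as $n_0$, such that $a_0,a_n\in\mathbb{Z}$, $a_1,\ldots,a_{n-1}$ are positive integers, and $$P\big(K_{n-1}(a_1,\ldots,a_{n-1})\big)=K_n(a_0,\ldots,a_{n-1})\,K_n(a_1,\ldots,a_n).$$ Then the map $$(a_0,\ldots,a_n)\mapsto (m,d_1,d_2):=\big(K_{n-1}(a_1,\ldots,a_{n-1}),\ K_n(a_0,\ldots,a_{n-1}),\ K_n(a_1,\ldots,a_n)\big)$$ is a bijection from the set of all such tuples onto the set of all factorisations $P(m)=d_1d_2$, that is, all triples $(m,d_1,d_2)$ with $m$ a positive integer, $d_1,d_2\in\mathbb{Z}$ and $P(m)=d_1d_2$.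
   Context: $K_k$ denotes the standard continuant: $K_0():=1$, $K_1(x_1):=x_1$ and $K_{k+1}(x_1,\ldots,x_{k+1})=x_{k+1}K_k(x_1,\ldots,x_k)+K_{k-1}(x_1,\ldots,x_{k-1})$.
   Formalization: The formal statement lets n range over n ≥ 1 (same parity as n_0) instead of n ≥ 2; for odd n_0 the printed claim fails since n ≥ 3 forces m ≥ 2, so no factorisation with m = 1 is attained (e.g. n_0 = 3, P = -1, (1,1,-1)). *)

theory Defs
  imports Complex_Main "HOL-Computational_Algebra.Polynomial"
begin

text \<open>Continuants are taken of initial segments of a 1-based sequence:
  \<open>continuant k x\<close> is $K_k(x_1,\ldots,x_k)$, and the value \<open>x 0\<close> is not used.\<close>

fun continuant :: "nat \<Rightarrow> (nat \<Rightarrow> int) \<Rightarrow> int" where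
  "continuant 0 x = 1"
| "continuant (Suc 0) x = x 1"
| "continuant (Suc (Suc k)) x = x (k + 2) * continuant (Suc k) x + continuant k x"

text \<open>A tuple $(a_0,\ldots,a_n)$ is a list of length $n + 1$. The argument of \<open>d1_of\<close>
  is shifted, so that the continuant is $K_n(a_0,\ldots,a_{n-1})$.\<close>

definition m_of :: "int list \<Rightarrow> int" where
  "m_of a = (let n = length a - 1 in continuant (n - 1) (\<lambda>i. a ! i))"

definition d1_of :: "int list \<Rightarrow> int" where
  "d1_of a = (let n = length a - 1 in continuant n (\<lambda>i. a ! (i - 1)))"

definition d2_of :: "int list \<Rightarrow> int" where
  "d2_of a = (let n = length a - 1 in continuant n (\<lambda>i. a ! i))"

text \<open>The lower bound is $n \ge 1$, not $n \ge 2$. For even $n_0$ the two bounds agree,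
  since $n$ is even. For odd $n_0$ the tuples $(a_0,a_1)$ with $n = 1$ are those with
  $m = K_0() = 1$, and they are needed: if $n \ge 3$ then $K_{n-1}(a_1,\ldots,a_{n-1}) \ge 2$,
  so no factorisation of $P(1)$ would be in the image
  (for example $P = -1$, $n_0 = 3$, $(m,d_1,d_2) = (1,1,-1)$).\<close>

definition continuant_solutions :: "int poly \<Rightarrow> nat \<Rightarrow> int list set" where
  "continuant_solutions P n0 =
     {a. \<exists>n\<ge>1. even n = even n0 \<and> length a = n + 1 \<and>
           (\<forall>i\<in>{1..n - 1}. a ! i > 0) \<and>
           poly P (m_of a) = d1_of a * d2_of a}"

definition factorisations :: "int poly \<Rightarrow> (int \<times> int \<times> int) set" where
  "factorisations P = {(m, d1, d2). m > 0 \<and> poly P m = d1 * d2}"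

end

theory Submission imports Defs begin

text \<open>
  The quotient of \<open>K_n(a_1,\<dots>,a_n)\<close> by \<open>K_{n-1}(a_1,\<dots>,a_{n-1})\<close> is the continued fraction
  \<open>[a_n; a_{n-1}, \<dots>, a_1]\<close>. So the pair \<open>(m, d_2)\<close> with \<open>m > 0\<close> determines \<open>a_1,\<dots>,a_n\<close>:
  they are the partial quotients produced by the Euclidean algorithm on \<open>d_2\<close> and \<open>m\<close>.
  A rational number has exactly two finite continued fraction expansions, ending in \<open>\<dots>, b\<close>
  with \<open>b \<ge> 2\<close> and in \<open>\<dots>, b - 1, 1\<close> (for an integer \<open>q\<close> they are \<open>[q]\<close> and \<open>[q - 1; 1]\<close>),
  and their lengths have different parities; prescribing the parity of \<open>n\<close> therefore leaves exactly one expansion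
  (\<open>continuant_expansion_exists\<close>, \<open>continuant_expansion_unique\<close>).

  The remaining entry \<open>a_0\<close> only affects \<open>d_1\<close>, which is an affine function of \<open>a_0\<close> with slope
  \<open>m\<close> (\<open>continuant_update_first\<close>). So \<open>a_0\<close> is unique, and it exists as soon as \<open>d_1\<close> lies in
  the correct residue class modulo \<open>m\<close>. By Euler's identity (\<open>continuant_euler\<close>) every tuple
  satisfies \<open>d_1 d_2 \<equiv> (-1)^n\<close> modulo \<open>m\<close>; every factorisation satisfies the same congruence,
  since \<open>P(m) \<equiv> P(0) = (-1)^{n_0}\<close>. That congruence also makes \<open>d_2\<close> invertible
  modulo \<open>m\<close>, so it fixes the class of \<open>d_1\<close>, and it provides the coprimality that the continued
  fraction expansion needs.
\<close>

section \<open>Continuant identities\<close>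

lemma continuant_cong:
  assumes "\<And>i. 1 \<le> i \<Longrightarrow> i \<le> k \<Longrightarrow> x i = y i"
  shows "continuant k x = continuant k y"
  using assms by (induction k x rule: continuant.induct) auto

text \<open>For positive entries this is one division step of the Euclidean algorithm on consecutive
  continuants: the last entry is the quotient.\<close>

lemma continuant_step:
  assumes "n \<ge> 2"
  shows "continuant n x = x n * continuant (n - 1) x + continuant (n - 2) x"
  using assms by (cases "(n, x)" rule: continuant.cases) auto

text \<open>The identity says that a product of \<open>n + 2\<close> matrices of determinant \<open>-1\<close> has
  determinant \<open>(-1)^n\<close>; the recursion multiplies by one more such matrix.\<close>

lemma continuant_euler:
  "continuant (Suc (Suc n)) x * continuant n (\<lambda>i. x (Suc i))
     - continuant (Suc n) x * continuant (Suc n) (\<lambda>i. x (Suc i)) = (-1) ^ n"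
proof (induction n)
  case 0
  show ?case by (simp add: numeral_2_eq_2)
next
  case (Suc n)
  have "continuant (Suc (Suc (Suc n))) x
          = x (n + 3) * continuant (Suc (Suc n)) x + continuant (Suc n) x"
    by (simp add: numeral_3_eq_3)
  moreover have "continuant (Suc (Suc n)) (\<lambda>i. x (Suc i))
          = x (n + 3) * continuant (Suc n) (\<lambda>i. x (Suc i)) + continuant n (\<lambda>i. x (Suc i))"
    by (simp add: numeral_3_eq_3)
  ultimately show ?case
    using Suc.IH by (simp add: algebra_simps del: continuant.simps)
qed

lemma continuant_update_first:
  "continuant (Suc k) (x(1 := c))
     = continuant (Suc k) x + (c - x 1) * continuant k (\<lambda>i. x (Suc i))"
proof (induction k rule: induct_nat_012)
  case (ge2 k)
  have step: "continuant (Suc (Suc (Suc k))) y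
          = y (k + 3) * continuant (Suc (Suc k)) y + continuant (Suc k) y" for y
    by (simp add: numeral_3_eq_3)
  have step': "continuant (Suc (Suc k)) (\<lambda>i. x (Suc i))
          = x (k + 3) * continuant (Suc k) (\<lambda>i. x (Suc i)) + continuant k (\<lambda>i. x (Suc i))"
    by (simp add: numeral_3_eq_3)
  have "continuant (Suc (Suc (Suc k))) (x(1 := c))
          = x (k + 3) * continuant (Suc (Suc k)) (x(1 := c)) + continuant (Suc k) (x(1 := c))"
    using step[of "x(1 := c)"] by simp
  then show ?case
    unfolding step[of x] step' ge2 by (simp only: algebra_simps)
qed (simp_all add: algebra_simps numeral_2_eq_2)

section \<open>Continued fraction expansions of prescribed parity\<close>

lemma continuant_pos:
  assumes "\<And>i. 1 \<le> i \<Longrightarrow> i \<le> k \<Longrightarrow> x i > 0"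
  shows "continuant k x > 0"
  using assms by (induction k x rule: continuant.induct) (auto intro: add_pos_pos)

text \<open>Strictness starts only at \<open>K_1 < K_2\<close>, because \<open>K_0 = K_1\<close> when the first entry is \<open>1\<close>.
  This exception is the source of the two expansions of a rational number.\<close>

lemma continuant_less_Suc:
  assumes "k \<ge> 1" and "\<And>i. 1 \<le> i \<Longrightarrow> i \<le> Suc k \<Longrightarrow> x i > 0"
  shows "continuant k x < continuant (Suc k) x"
proof -
  obtain j where k: "k = Suc j" using assms(1) by (cases k) auto
  have "continuant k x > 0" "continuant j x > 0"
    using assms(2) k by (auto intro!: continuant_pos)
  moreover have "x (Suc k) \<ge> 1" using assms(2)[of "Suc k"] by simp
  ultimately have "continuant k x \<le> x (Suc k) * continuant k x"
    by (simp add: mult_le_cancel_right1)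
  then show ?thesis using \<open>continuant j x > 0\<close> k by simp
qed

lemma continuant_le_Suc:
  assumes "\<And>i. 1 \<le> i \<Longrightarrow> i \<le> Suc k \<Longrightarrow> x i > 0"
  shows "continuant k x \<le> continuant (Suc k) x"
proof (cases "k = 0")
  case True
  then show ?thesis using assms[of 1] by simp
next
  case False
  then show ?thesis using continuant_less_Suc[of k x] assms by simp
qed

text \<open>The Euclidean algorithm, run on \<open>(q, m)\<close>: one division replaces the pair by
  \<open>(m, q mod m)\<close> and flips the parity still to be achieved. When the denominator reaches \<open>1\<close>,
  either of the expansions \<open>[q]\<close> and \<open>[q - 1; 1]\<close> can be chosen, which settles the parity.\<close>

lemma continuant_expansion_exists:
  assumes "m > 0" and "coprime q m"
  shows "\<exists>n x. n \<ge> 1 \<and> even n = e \<and> (\<forall>i\<in>{1..n - 1}. x i > 0)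
           \<and> continuant (n - 1) x = m \<and> continuant n x = q"
  using assms
proof (induction "nat m" arbitrary: m q e rule: less_induct)
  case less
  show ?case
  proof (cases "m = 1")
    case True
    show ?thesis
    proof (cases e)
      case True
      show ?thesis
        by (rule exI[of _ 2], rule exI[of _ "\<lambda>i. if i = 1 then 1 else q - 1"])
          (use \<open>e\<close> \<open>m = 1\<close> in \<open>auto simp: numeral_2_eq_2\<close>)
    next
      case False
      show ?thesis
        by (rule exI[of _ 1], rule exI[of _ "\<lambda>_. q"]) (use \<open>\<not> e\<close> \<open>m = 1\<close> in auto)
    qed
  next
    case False
    define r where "r = q mod m"
    have cop: "coprime m r"
      using less.prems by (simp add: r_def coprime_commute)
    have "r \<noteq> 0" using cop False less.prems by auto
    then have r: "0 < r" "r < m"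
      using pos_mod_bound[of m q] pos_mod_sign[of m q] less.prems(1)
      unfolding r_def by linarith+
    obtain n x where n: "n \<ge> 1" "even n = (\<not> e)" and pos: "\<forall>i\<in>{1..n - 1}. x i > 0"
      and Kr: "continuant (n - 1) x = r" and Km: "continuant n x = m"
      using less.hyps[of r m "\<not> e"] r cop by (auto simp: nat_less_eq_zless)
    \<comment> \<open>The induction hypothesis leaves the last quotient free; it is positive since \<open>m > r\<close>.\<close>
    have last: "x n > 0"
    proof (cases "n = 1")
      case True
      then show ?thesis using Km r by simp
    next
      case False
      then have "continuant (n - 2) x \<le> continuant (Suc (n - 2)) x"
        using pos n by (intro continuant_le_Suc) auto
      also have "Suc (n - 2) = n - 1" using False n by simp
      finally have "continuant (n - 2) x \<le> r" using Kr by simp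
      moreover have "m = x n * r + continuant (n - 2) x"
        using continuant_step[of n x] False n Kr Km by simp
      ultimately have "x n * r > 0" using r by simp
      then show ?thesis using r by (simp add: zero_less_mult_iff)
    qed
    define y where "y = x(Suc n := q div m)"
    have "y (Suc n) = q div m" by (simp add: y_def)
    have agree: "continuant k y = continuant k x" if "k \<le> n" for k
      by (rule continuant_cong) (use that in \<open>auto simp: y_def\<close>)
    have "continuant (Suc n) y = y (Suc n) * continuant n y + continuant (n - 1) y"
      using continuant_step[of "Suc n" y] n by simp
    also have "\<dots> = q"
      using Km Kr agree[of n] agree[of "n - 1"] \<open>y (Suc n) = q div m\<close> by (simp add: r_def)
    finally have "continuant (Suc n) y = q" .
    moreover have "\<forall>i\<in>{1..Suc n - 1}. y i > 0"
    proof
      fix i assume i: "i \<in> {1..Suc n - 1}"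
      then have "i = n \<or> i \<in> {1..n - 1}" by auto
      then show "y i > 0" using i last pos by (auto simp: y_def)
    qed
    moreover have "continuant (Suc n - 1) y = m" using Km by (simp add: agree)
    moreover have "even (Suc n) = e" using n by simp
    ultimately show ?thesis by (intro exI[of _ "Suc n"] exI[of _ y]) simp
  qed
qed

text \<open>As long as the denominator \<open>K_{n-1}\<close> exceeds \<open>1\<close>, the bounds \<open>0 < K_{n-2} < K_{n-1}\<close>
  identify the recursion step with division with remainder, so that the last entries agree and
  the expansions can be shortened. Denominator \<open>1\<close> forces a length of \<open>1\<close> or \<open>2\<close>, and
  there the parity decides.\<close>

lemma continuant_expansion_unique:
  assumes "n \<ge> 1" "n' \<ge> 1" "even n = even n'"
    and "\<forall>i\<in>{1..n - 1}. x i > 0" "\<forall>i\<in>{1..n' - 1}. y i > 0"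
    and "continuant (n - 1) x = continuant (n' - 1) y"
    and "continuant n x = continuant n' y"
  shows "n = n' \<and> (\<forall>i\<in>{1..n}. x i = y i)"
  using assms
proof (induction n arbitrary: n')
  case 0
  then show ?case by simp
next
  case (Suc k)
  have small: "j \<le> 2" if "continuant (j - 1) z = 1" "\<forall>i\<in>{1..j - 1}. z i > 0"
    for j and z :: "nat \<Rightarrow> int"
  proof (rule ccontr)
    assume "\<not> j \<le> 2"
    then have "continuant (j - 2) z < continuant (Suc (j - 2)) z"
      using that by (intro continuant_less_Suc) auto
    moreover have "continuant (j - 2) z > 0"
      using that by (intro continuant_pos) auto
    moreover have "Suc (j - 2) = j - 1" using \<open>\<not> j \<le> 2\<close> by simp
    ultimately show False using that by simp
  qed
  have large: "j \<ge> 2 \<and> 0 < continuant (j - 2) z \<and> continuant (j - 2) z < continuant (j - 1) z"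
    if "continuant (j - 1) z \<noteq> 1" "\<forall>i\<in>{1..j - 1}. z i > 0"
    for j and z :: "nat \<Rightarrow> int"
  proof -
    have j: "j \<ge> 2" using that(1) by (cases "(j, z)" rule: continuant.cases) auto
    have "continuant (j - 2) z > 0" using that by (intro continuant_pos) auto
    moreover have "continuant (j - 2) z < continuant (j - 1) z"
    proof (cases "j = 2")
      case True
      then show ?thesis using that by force
    next
      case False
      then have "continuant (j - 2) z < continuant (Suc (j - 2)) z"
        using that j by (intro continuant_less_Suc) auto
      then show ?thesis using False j by (simp add: Suc_diff_le numeral_2_eq_2 Suc_diff_Suc)
    qed
    ultimately show ?thesis using j by simp
  qed
  show ?case
  proof (cases "continuant k x = 1")
    case True
    have "Suc k \<le> 2" "n' \<le> 2"
      using small[of "Suc k" x] small[of n' y] True Suc.prems by auto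
    then have "n' = Suc k" "k = 0 \<or> k = 1"
      using Suc.prems by (auto simp: le_Suc_eq numeral_2_eq_2)
    then show ?thesis
    proof (elim disjE)
      assume "k = 0"
      then show ?thesis using Suc.prems \<open>n' = Suc k\<close> by simp
    next
      assume "k = 1"
      then have "x 1 = 1" "y 1 = 1" "x 2 = y 2"
        using True Suc.prems \<open>n' = Suc k\<close> by (auto simp: numeral_2_eq_2)
      moreover have "{1..Suc k} = {1, 2}" using \<open>k = 1\<close> by auto
      ultimately show ?thesis using \<open>n' = Suc k\<close> by simp
    qed
  next
    case False
    define m where "m = continuant k x"
    have my: "continuant (n' - 1) y = m" using Suc.prems by (simp add: m_def)
    have X: "k \<ge> 1" "0 < continuant (k - 1) x" "continuant (k - 1) x < m"
      using large[of "Suc k" x] False Suc.prems by (auto simp: m_def Suc_le_eq)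
    have Y: "n' \<ge> 2" "0 < continuant (n' - 2) y" "continuant (n' - 2) y < m"
      using large[of n' y] False Suc.prems my by (auto simp: m_def)
    have qx: "continuant (Suc k) x = x (Suc k) * m + continuant (k - 1) x"
      using continuant_step[of "Suc k" x] X by (simp add: m_def)
    have qy: "continuant (Suc k) x = y n' * m + continuant (n' - 2) y"
      using continuant_step[of n' y] Y my Suc.prems by simp
    have "x (Suc k) = continuant (Suc k) x div m" "continuant (k - 1) x = continuant (Suc k) x mod m"
      unfolding qx using X by auto
    moreover have "y n' = continuant (Suc k) x div m" "continuant (n' - 2) y = continuant (Suc k) x mod m"
      unfolding qy using Y by auto
    ultimately have eq: "x (Suc k) = y n'" "continuant (k - 1) x = continuant (n' - 2) y"
      by simp_all
    have "k = n' - 1 \<and> (\<forall>i\<in>{1..k}. x i = y i)"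
    proof (rule Suc.IH)
      show "continuant (k - 1) x = continuant (n' - 1 - 1) y"
        using eq by (simp add: numeral_2_eq_2)
    qed (use X Y my Suc.prems in \<open>auto simp: m_def\<close>)
    then have "n' = Suc k" "\<forall>i\<in>{1..k}. x i = y i" using Y by auto
    then show ?thesis using eq by (auto simp: le_Suc_eq)
  qed
qed

section \<open>Tuples and factorisations\<close>

lemma d1_d2_eq:
  assumes "length a = n + 1" "n \<ge> 1"
  shows "\<exists>t. d1_of a * d2_of a = t * m_of a + (-1) ^ n"
proof -
  obtain k where n: "n = Suc k" using assms by (cases n) auto
  show ?thesis
    using continuant_euler[of k "\<lambda>i. a ! (i - 1)"] assms n
    by (intro exI[of _ "continuant (Suc (Suc k)) (\<lambda>i. a ! (i - 1))"])
      (simp add: m_of_def d1_of_def d2_of_def del: continuant.simps)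
qed

lemma d1_of_Cons:
  assumes "length b = n" "n \<ge> 1"
  shows "d1_of (c # b) = d1_of (c' # b) + (c - c') * m_of (c' # b)"
proof -
  obtain k where n: "n = Suc k" using assms by (cases n) auto
  let ?x = "\<lambda>i. (c' # b) ! (i - 1)"
  have "d1_of (c # b) = continuant (Suc k) (?x(1 := c))"
    using assms n unfolding d1_of_def Let_def
    by (auto intro!: continuant_cong simp: nth_Cons')
  then show ?thesis
    using continuant_update_first[of k ?x c] assms n
    by (simp add: m_of_def d1_of_def del: continuant.simps)
qed

lemma m_of_Cons:
  assumes "length b = n" "n \<ge> 1" "\<And>i. i < n \<Longrightarrow> b ! i = x (Suc i)"
  shows "m_of (c # b) = continuant (n - 1) x"
  using assms by (auto simp: m_of_def intro!: continuant_cong)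

lemma d2_of_Cons:
  assumes "length b = n" "n \<ge> 1" "\<And>i. i < n \<Longrightarrow> b ! i = x (Suc i)"
  shows "d2_of (c # b) = continuant n x"
  using assms by (auto simp: d2_of_def intro!: continuant_cong)

lemma poly_eq_coeff_0_plus_multiple:
  fixes p :: "'a::comm_semiring_1 poly"
  shows "\<exists>t. poly p m = t * m + coeff p 0"
proof (cases p)
  case (pCons c q)
  then show ?thesis by (intro exI[of _ "poly q m"]) (simp add: algebra_simps)
qed

theorem mainTheorem3:
  fixes P :: "int poly" and d n0 :: nat and C :: real
  assumes "n0 \<ge> 2"
    and "degree P \<le> d"
    and "coeff P 0 = (-1) ^ n0"
    and "C \<noteq> 0"
    and "\<And>x::real. x \<noteq> 0 \<Longrightarrow>
           x ^ d * poly (map_poly of_int P) ((-1) ^ (n0 - 1) * inverse x)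
             = C * poly (map_poly of_int P) x"
  shows "bij_betw (\<lambda>a. (m_of a, d1_of a, d2_of a))
           (continuant_solutions P n0) (factorisations P)"
proof -
  let ?f = "\<lambda>a. (m_of a, d1_of a, d2_of a)"
  have mpos: "m_of a > 0" if "a \<in> continuant_solutions P n0" for a
    using that by (auto simp: continuant_solutions_def m_of_def intro!: continuant_pos)
  have inj: "inj_on ?f (continuant_solutions P n0)"
  proof (rule inj_onI)
    fix a a' assume a: "a \<in> continuant_solutions P n0" and a': "a' \<in> continuant_solutions P n0"
      and eq: "?f a = ?f a'"
    obtain n where n: "n \<ge> 1" "even n = even n0" "length a = n + 1" "\<forall>i\<in>{1..n - 1}. a ! i > 0"
      using a by (auto simp: continuant_solutions_def)
    obtain n' where n': "n' \<ge> 1" "even n' = even n0" "length a' = n' + 1"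
      "\<forall>i\<in>{1..n' - 1}. a' ! i > 0"
      using a' by (auto simp: continuant_solutions_def)
    have "n = n' \<and> (\<forall>i\<in>{1..n}. a ! i = a' ! i)"
      using eq n n' by (intro continuant_expansion_unique) (auto simp: m_of_def d2_of_def)
    then have nn: "n' = n" and ent: "\<And>i. 1 \<le> i \<Longrightarrow> i \<le> n \<Longrightarrow> a ! i = a' ! i" by auto
    obtain c b where ab: "a = c # b" using n by (cases a) auto
    obtain c' b' where ab': "a' = c' # b'" using n' by (cases a') auto
    have "b = b'"
    proof (rule nth_equalityI)
      show "length b = length b'" using n n' nn ab ab' by simp
      fix i assume "i < length b"
      then show "b ! i = b' ! i" using ent[of "Suc i"] ab ab' n by simp
    qed
    then have "(c - c') * m_of a' = 0"
      using d1_of_Cons[of b n c c'] eq n ab ab' by simp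
    then show "a = a'" using mpos[OF a'] ab ab' \<open>b = b'\<close> by simp
  qed
  have "?f ` continuant_solutions P n0 \<subseteq> factorisations P"
    using mpos by (auto simp: factorisations_def) (auto simp: continuant_solutions_def)
  moreover have "factorisations P \<subseteq> ?f ` continuant_solutions P n0"
  proof (clarsimp simp: factorisations_def)
    fix m d1 d2 :: int assume m: "m > 0" and fac: "poly P m = d1 * d2"
    obtain t where t: "d1 * d2 = t * m + (-1) ^ n0"
      using poly_eq_coeff_0_plus_multiple[of P m] assms(3) fac by auto
    have cop: "coprime d2 m"
    proof (rule coprimeI)
      fix g assume "g dvd d2" "g dvd m"
      then have "g dvd d1 * d2 - t * m" by auto
      then show "is_unit g" using t by (cases "even n0") auto
    qed
    obtain n x where n: "n \<ge> 1" "even n = even n0" and pos: "\<forall>i\<in>{1..n - 1}. x i > 0"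
      and Km: "continuant (n - 1) x = m" and Kd: "continuant n x = d2"
      using continuant_expansion_exists[OF m cop] by blast
    define b where "b = map x [1..<n + 1]"
    have len: "length b = n" and nth: "\<And>i. i < n \<Longrightarrow> b ! i = x (Suc i)"
      by (auto simp: b_def nth_append simp del: upt_Suc)
    have mb: "m_of (c # b) = m" and db: "d2_of (c # b) = d2" for c
      using m_of_Cons[of b n x c] d2_of_Cons[of b n x c] len nth n Km Kd by auto
    define D where "D = d1_of (0 # b)"
    obtain s where s: "D * d2 = s * m + (-1) ^ n"
      using d1_d2_eq[of "0 # b" n] len n mb db by (auto simp: D_def)
    have "(-1) ^ n = (-1 :: int) ^ n0" using n by (simp add: minus_one_power_iff)
    then have "(d1 - D) * d2 = (t - s) * m" using s t by (simp add: algebra_simps)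
    then have "m dvd d1 - D"
      using cop by (metis coprime_commute coprime_dvd_mult_left_iff dvd_triv_right)
    then obtain c where c: "d1 - D = m * c" by blast
    have d1c: "d1_of (c # b) = d1"
      using d1_of_Cons[of b n c 0] len n mb c by (simp add: D_def algebra_simps)
    have "c # b \<in> continuant_solutions P n0"
      unfolding continuant_solutions_def using n len nth pos fac mb db d1c
      by (auto simp: nth_Cons' intro!: exI[of _ n])
    then show "(m, d1, d2) \<in> ?f ` continuant_solutions P n0"
      using mb db d1c by (auto intro!: image_eqI[of _ _ "c # b"])
  qed
  ultimately show ?thesis using inj by (auto simp: bij_betw_def)
qed

end
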